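(* Let $p,q>1$ be relatively prime integers. If $U\notin\mathbb{N}$ then $W(U)=0$. For every integer $U\ge1$, $$W(U)=W_p(U)+W\!\left(\frac{U}{q}\right)+\sum_{c=0}^{\lfloor\log_p(U/(q+1))\rfloor}\delta_{p,q}(c,U)\,W\!\left(\left\lfloor\frac{U}{p^cq}\right\rfloor\right),$$ where $\delta_{p,q}(c,U)=1$ if $\lfloor U/p^c\rfloor\equiv1\pmod q$ and $W_p(U\bmod p^c)=1$, and $\delta_{p,q}(c,U)=0$ otherwise.
   Context: A strictly chained $(p,q)$-ary partition of $U$ is a finite sequence of distinct positive integers of the form $p^aq^b$ ($a,b\ge0$) summing to $U$, in decreasing order, each part a multiple of the next. $W(U)$ is the number of such partitions of $U$, with $W(0)=1$ and $W(x)=0$ if $x$ is not a nonnegative integer. $W_p(U)\in\{0,1\}$ is the number of partitions of $U$ into distinct parts that are powers of $p$ (i.e. $W_p(U)=1$ iff $U$ has a base-$p$ expansion using only digits $0$ and $1$); $W_p(0)=1$. *)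

theory Defs
  imports Complex_Main "HOL-Number_Theory.Cong"
begin

definition strictly_chained :: "nat \<Rightarrow> nat \<Rightarrow> nat list \<Rightarrow> bool" where
  "strictly_chained p q xs \<longleftrightarrow>
     (\<forall>x \<in> set xs. \<exists>a b. x = p ^ a * q ^ b) \<and>
     sorted_wrt (>) xs \<and>
     successively (\<lambda>x y. y dvd x) xs"

text \<open>
  The argument is real so that \<open>W p q (U / q)\<close> makes sense for every \<open>U\<close>; no list of natural
  numbers sums to an argument that is not a natural number.
\<close>
definition W :: "nat \<Rightarrow> nat \<Rightarrow> real \<Rightarrow> nat" where
  "W p q u = card {xs. strictly_chained p q xs \<and> real (sum_list xs) = u}"

text \<open>A partition into distinct parts is represented by the finite set of its parts.\<close>
definition Wp :: "nat \<Rightarrow> nat \<Rightarrow> nat" where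
  "Wp p n = card {S. finite S \<and> S \<subseteq> range (\<lambda>a. p ^ a) \<and> \<Sum>S = n}"

definition delta :: "nat \<Rightarrow> nat \<Rightarrow> nat \<Rightarrow> nat \<Rightarrow> nat" where
  "delta p q c U = (if [U div p ^ c = 1] (mod q) \<and> Wp p (U mod p ^ c) = 1 then 1 else 0)"

text \<open>The set counted by \<open>W\<close> is finite, so \<open>card\<close> does not collapse to \<open>0\<close>.\<close>
lemma finite_strictly_chained:
  assumes "p > 1" "q > 1"
  shows "finite {xs. strictly_chained p q xs \<and> real (sum_list xs) = u}"
proof -
  define n where "n = nat \<lfloor>u\<rfloor>"
  have "{xs. strictly_chained p q xs \<and> real (sum_list xs) = u}
          \<subseteq> {xs. set xs \<subseteq> {..n} \<and> length xs \<le> n}"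
  proof clarify
    fix xs assume xs: "strictly_chained p q xs" and u: "u = real (sum_list xs)"
    have n: "n = sum_list xs" using u by (simp add: n_def)
    have pos: "\<forall>x \<in> set xs. x \<ge> 1"
      using xs assms by (auto simp: strictly_chained_def Suc_le_eq)
    have "length xs \<le> sum_list xs" using pos by (induction xs) auto
    then show "set xs \<subseteq> {..n} \<and> length xs \<le> n"
      using n member_le_sum_list by auto
  qed
  then show ?thesis by (rule finite_subset) (simp add: finite_lists_length_le)
qed

lemma W_0:
  assumes "p > 1" "q > 1"
  shows "W p q 0 = 1"
proof -
  have "{xs. strictly_chained p q xs \<and> real (sum_list xs) = 0} = {[]}"
  proof (intro equalityI subsetI)
    fix xs assume "xs \<in> {xs. strictly_chained p q xs \<and> real (sum_list xs) = 0}"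
    then show "xs \<in> {[]}" using assms by (cases xs) (auto simp: strictly_chained_def)
  qed (auto simp: strictly_chained_def)
  then show ?thesis by (simp add: W_def)
qed

end

theory Submission
  imports Defs "HOL-Library.FuncSet"
begin

text \<open>
  Split a chained partition of \<open>U\<close> into the parts divisible by \<open>q\<close> followed by the powers of \<open>p\<close>.
  If the second block is empty, dividing by \<open>q\<close> gives a partition of \<open>U / q\<close>; if the first block
  is empty, it is a partition into distinct powers of \<open>p\<close>. Otherwise let \<open>p ^ c\<close> be the largest
  power of \<open>p\<close> in the second block. It divides every part of the first block, so
  \<open>U = p ^ c * q * V + p ^ c + R\<close>, where \<open>V \<ge> 1\<close> is the sum of a chained partition and \<open>R < p ^ c\<close>
  is a sum of distinct smaller powers of \<open>p\<close>. Hence \<open>U\<close> and \<open>c\<close> determine \<open>V\<close> and \<open>R\<close>.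
\<close>

section \<open>Partitions as decreasing lists\<close>

definition chained_partitions :: "nat \<Rightarrow> nat \<Rightarrow> nat \<Rightarrow> nat list set" where
  "chained_partitions p q n = {xs. strictly_chained p q xs \<and> sum_list xs = n}"

text \<open>Decreasing lists, unlike the sets counted by \<open>Wp\<close>, can occur as tails of
  the lists counted by \<open>W\<close>.\<close>

definition distinct_powers :: "nat \<Rightarrow> nat list \<Rightarrow> bool" where
  "distinct_powers p xs \<longleftrightarrow> sorted_wrt (>) xs \<and> set xs \<subseteq> range (\<lambda>a. p ^ a)"

lemma distinct_powers_Nil [simp]: "distinct_powers p []"
  by (simp add: distinct_powers_def)

lemma distinct_powers_Cons:
  "distinct_powers p (x # xs) \<longleftrightarrow>
     (\<exists>a. x = p ^ a) \<and> (\<forall>y \<in> set xs. y < x) \<and> distinct_powers p xs"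
  by (auto simp: distinct_powers_def)

text \<open>Divisibility is transitive, so the condition on neighbours extends to all pairs. The
  pairwise form splits well when a list is cut into blocks.\<close>

lemma strictly_chained_iff:
  "strictly_chained p q xs \<longleftrightarrow>
     (\<forall>x \<in> set xs. \<exists>a b. x = p ^ a * q ^ b) \<and> sorted_wrt (\<lambda>x y. y < x \<and> y dvd x) xs"
proof -
  have "transp (\<lambda>x y :: nat. y dvd x)"
    by (auto intro: transpI dvd_trans)
  then have "successively (\<lambda>x y. y dvd x) xs \<longleftrightarrow> sorted_wrt (\<lambda>x y. y dvd x) xs"
    by (simp add: successively_conv_sorted_wrt)
  moreover have "sorted_wrt (>) xs \<and> sorted_wrt (\<lambda>x y. y dvd x) xs \<longleftrightarrow>
      sorted_wrt (\<lambda>x y. y < x \<and> y dvd x) xs"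
    by (induction xs) auto
  ultimately show ?thesis
    by (auto simp: strictly_chained_def)
qed

lemma W_of_nat: "W p q (real n) = card (chained_partitions p q n)"
  by (simp add: W_def chained_partitions_def)

lemma finite_chained_partitions:
  "p > 1 \<Longrightarrow> q > 1 \<Longrightarrow> finite (chained_partitions p q n)"
  using finite_strictly_chained[of p q "real n"] by (simp add: chained_partitions_def)

text \<open>Clearing the denominator avoids a case split on whether \<open>q\<close> divides
  \<open>n\<close>: if it does not, both sides are 0.\<close>

lemma W_divide:
  assumes "q > 0"
  shows "W p q (real n / real q) = card {xs. strictly_chained p q xs \<and> q * sum_list xs = n}"
proof -
  have "real m = real n / real q \<longleftrightarrow> q * m = n" for m
    using assms by (simp add: field_simps flip: of_nat_mult)
  then show ?thesis
    by (simp add: W_def)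
qed

lemma W_not_Nats: "u \<notin> \<nat> \<Longrightarrow> W p q u = 0"
  by (auto simp: W_def card_eq_0_iff)

text \<open>Each finite set of naturals has exactly one strictly decreasing enumeration.\<close>

lemma Wp_eq_card_lists: "Wp p n = card {xs. distinct_powers p xs \<and> sum_list xs = n}"
proof -
  have distinct: "distinct xs" if "distinct_powers p xs" for xs
    using that by (induction xs) (auto simp: distinct_powers_Cons)
  have "bij_betw set {xs. distinct_powers p xs \<and> sum_list xs = n}
      {S. finite S \<and> S \<subseteq> range (\<lambda>a. p ^ a) \<and> \<Sum>S = n}"
  proof (rule bij_betwI[where g = "\<lambda>S. rev (sorted_list_of_set S)"])
    show "set \<in> {xs. distinct_powers p xs \<and> sum_list xs = n} \<rightarrow>
        {S. finite S \<and> S \<subseteq> range (\<lambda>a. p ^ a) \<and> \<Sum>S = n}"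
      using distinct by (auto simp: distinct_powers_def sum_list_distinct_conv_sum_set[where f = id, simplified])
  next
    show "(\<lambda>S. rev (sorted_list_of_set S)) \<in> {S. finite S \<and> S \<subseteq> range (\<lambda>a. p ^ a) \<and> \<Sum>S = n} \<rightarrow>
        {xs. distinct_powers p xs \<and> sum_list xs = n}"
      by (auto simp: distinct_powers_def sorted_wrt_rev
          sum_list_distinct_conv_sum_set[where f = id, simplified])
  next
    fix xs assume "xs \<in> {xs. distinct_powers p xs \<and> sum_list xs = n}"
    then have "sorted_wrt (<) (rev xs)"
      by (simp add: distinct_powers_def sorted_wrt_rev)
    then have "sorted_list_of_set (set (rev xs)) = rev xs"
      using sorted_list_of_set.idem_if_sorted_distinct strict_sorted_iff by blast
    then show "rev (sorted_list_of_set (set xs)) = xs"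
      by simp
  qed auto
  then show ?thesis
    by (simp add: Wp_def bij_betw_same_card)
qed

section \<open>Uniqueness of sums of distinct powers of \<open>p\<close>\<close>

text \<open>By induction the tail sums to less than the head \<open>p ^ a\<close>, so the whole sum
  is below \<open>2 * p ^ a\<close>, which is at most \<open>p ^ Suc a\<close>, and
  \<open>a < c\<close>.\<close>

lemma distinct_powers_sum_less:
  assumes "p > 1" "distinct_powers p xs" "\<forall>x \<in> set xs. x < p ^ c"
  shows "sum_list xs < p ^ c"
  using assms(2,3)
proof (induction xs arbitrary: c)
  case (Cons x xs)
  then obtain a where a: "x = p ^ a" and "\<forall>y \<in> set xs. y < p ^ a" "distinct_powers p xs"
    by (auto simp: distinct_powers_Cons)
  then have "sum_list xs < p ^ a"
    using Cons.IH by blast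
  moreover have "a < c"
    using Cons.prems(2) a assms(1) by simp
  then have "p ^ Suc a \<le> p ^ c"
    using assms(1) by (intro power_increasing) auto
  moreover have "2 * p ^ a \<le> p ^ Suc a"
    using assms(1) by simp
  ultimately show ?case
    unfolding a sum_list.Cons by linarith
qed (use assms(1) in simp)

text \<open>A larger \<open>y\<close> would be a power of \<open>p\<close> exceeding every part of
  \<open>x # xs\<close>, hence exceeding their sum.\<close>

lemma distinct_powers_hd_le:
  assumes "p > 1" "distinct_powers p (x # xs)" "distinct_powers p (y # ys)"
    and "sum_list (x # xs) = sum_list (y # ys)"
  shows "y \<le> x"
proof (rule ccontr)
  assume "\<not> y \<le> x"
  moreover obtain b where "y = p ^ b"
    using assms(3) by (auto simp: distinct_powers_Cons)
  ultimately have "\<forall>z \<in> set (x # xs). z < p ^ b"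
    using assms(2) by (auto simp: distinct_powers_Cons)
  then have "sum_list (x # xs) < y"
    using distinct_powers_sum_less[OF assms(1,2)] \<open>y = p ^ b\<close> by blast
  then show False
    using assms(4) by simp
qed

text \<open>Applied in both directions, \<open>distinct_powers_hd_le\<close> forces equal heads;
  cancelling them leaves tails with equal sums.\<close>

lemma distinct_powers_unique:
  assumes "p > 1" "distinct_powers p xs" "distinct_powers p ys" "sum_list xs = sum_list ys"
  shows "xs = ys"
  using assms(2-)
proof (induction xs arbitrary: ys)
  case Nil
  then show ?case
    using assms(1) by (cases ys) (auto simp: distinct_powers_Cons)
next
  case (Cons x xs)
  then obtain y ys' where ys: "ys = y # ys'"
    using assms(1) by (cases ys) (auto simp: distinct_powers_Cons)
  have "x = y"
    using distinct_powers_hd_le[OF assms(1)] Cons.prems unfolding ys by (metis le_antisym)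
  then show ?case
    using Cons unfolding ys by (auto simp: distinct_powers_Cons)
qed

lemma Wp_le_1:
  assumes "p > 1"
  shows "Wp p n \<le> 1"
proof -
  have "xs = ys" if "distinct_powers p xs \<and> sum_list xs = n" "distinct_powers p ys \<and> sum_list ys = n"
    for xs ys
    using distinct_powers_unique[OF assms] that by simp
  \<comment> \<open>An infinite set would have \<open>card\<close> 0, which also satisfies the
    bound.\<close>
  then have "card {xs. distinct_powers p xs \<and> sum_list xs = n} \<le> Suc 0"
    by (cases "finite {xs. distinct_powers p xs \<and> sum_list xs = n}") (auto simp: card_le_Suc0_iff_eq)
  then show ?thesis
    by (simp add: Wp_eq_card_lists)
qed

text \<open>As \<open>Wp\<close> takes only the values 0 and 1, the indicator of
  \<open>Wp = 1\<close> is \<open>Wp\<close> itself. This lets \<open>delta\<close> count the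
  choices of a lower block.\<close>

lemma delta_eq:
  assumes "p > 1"
  shows "delta p q c n = (if [n div p ^ c = 1] (mod q) then Wp p (n mod p ^ c) else 0)"
  using Wp_le_1[OF assms, of "n mod p ^ c"] by (auto simp: delta_def)

section \<open>Powers of \<open>p\<close> and divisibility by \<open>q\<close>\<close>

lemma not_dvd_power_coprime:
  fixes p q :: nat
  assumes "q > 1" "coprime p q"
  shows "\<not> q dvd p ^ a"
  using assms coprime_common_divisor_nat[of "p ^ a" q q] by auto

text \<open>Of two powers of \<open>p\<close> the smaller divides the larger.\<close>

lemma distinct_powers_chained:
  assumes "p > 1" "distinct_powers p xs"
  shows "strictly_chained p q xs"
proof -
  have "sorted_wrt (\<lambda>x y. y < x \<and> y dvd x) xs"
    using assms(2)
  proof (induction xs)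
    case (Cons x xs)
    have "y dvd x" if "y \<in> set xs" for y
    proof -
      have "x \<in> range (\<lambda>a. p ^ a)" "y \<in> range (\<lambda>a. p ^ a)"
        using Cons.prems that by (auto simp: distinct_powers_def simp del: image_iff)
      then obtain a b where "x = p ^ a" "y = p ^ b"
        by blast
      moreover have "y < x"
        using Cons.prems that by (auto simp: distinct_powers_Cons)
      ultimately show ?thesis
        using assms(1) by (auto intro: le_imp_power_dvd)
    qed
    then show ?case
      using Cons by (auto simp: distinct_powers_Cons)
  qed simp
  moreover have "\<exists>a b. x = p ^ a * q ^ b" if "x \<in> set xs" for x
  proof -
    have "x \<in> range (\<lambda>a. p ^ a)"
      using assms(2) that by (auto simp: distinct_powers_def simp del: image_iff)
    then obtain a where "x = p ^ a * q ^ 0"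
      by auto
    then show ?thesis
      by blast
  qed
  ultimately show ?thesis
    by (auto simp: strictly_chained_iff)
qed

lemma not_dvd_distinct_powers:
  assumes "q > 1" "coprime p q" "distinct_powers p xs" "x \<in> set xs"
  shows "\<not> q dvd x"
  using assms not_dvd_power_coprime[OF assms(1,2)] by (auto simp: distinct_powers_def)

lemma chained_not_dvd_distinct_powers:
  assumes "strictly_chained p q xs" "\<forall>x \<in> set xs. \<not> q dvd x"
  shows "distinct_powers p xs"
  unfolding distinct_powers_def
proof
  show "sorted_wrt (>) xs"
    using assms(1) by (simp add: strictly_chained_def)
  show "set xs \<subseteq> range (\<lambda>a. p ^ a)"
  proof
    fix x assume x: "x \<in> set xs"
    then obtain a b where ab: "x = p ^ a * q ^ b"
      using assms(1) by (auto simp: strictly_chained_def)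
    have "b = 0"
      using assms(2) x ab by (cases b) auto
    then show "x \<in> range (\<lambda>a. p ^ a)"
      using ab by simp
  qed
qed

section \<open>Scaling chained partitions\<close>

text \<open>The exponents \<open>c = 0\<close>, \<open>d = 1\<close> serve the partitions of
  \<open>n / q\<close>; general \<open>c\<close> with \<open>d = 1\<close> serves the upper block of
  a mixed partition.\<close>

lemma strictly_chained_scale:
  assumes "p > 0" "q > 0" "strictly_chained p q ys"
  shows "strictly_chained p q (map ((*) (p ^ c * q ^ d)) ys)"
proof -
  have "\<exists>a' b'. p ^ c * q ^ d * (p ^ a * q ^ b) = p ^ a' * q ^ b'" for a b
    by (rule exI[of _ "c + a"], rule exI[of _ "d + b"]) (simp add: power_add)
  then show ?thesis
    using assms by (fastforce simp: strictly_chained_iff sorted_wrt_map)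
qed

text \<open>The point is that quotients keep the form \<open>p ^ a * q ^ b\<close>. Coprimality
  forces \<open>c \<le> a\<close> and \<open>b \<ge> 1\<close> in each part, so \<open>c\<close> and
  1 can be subtracted from the exponents.\<close>

lemma strictly_chained_unscale:
  assumes "p > 1" "q > 1" "coprime p q" "strictly_chained p q xs"
    and dvd: "\<forall>x \<in> set xs. p ^ c * q dvd x"
  obtains ys where "strictly_chained p q ys" "xs = map ((*) (p ^ c * q)) ys"
proof
  let ?m = "p ^ c * q"
  define ys where "ys = map (\<lambda>x. x div ?m) xs"
  show xs: "xs = map ((*) ?m) ys"
    using dvd by (auto simp: ys_def intro!: map_idI[symmetric])
  \<comment> \<open>Multiplication by the positive \<open>?m\<close> reflects both \<open><\<close>
    and \<open>dvd\<close>.\<close>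
  have "sorted_wrt (\<lambda>x y. y < x \<and> y dvd x) ys"
    using assms(1,2,4) unfolding strictly_chained_iff by (subst (asm) (2) xs) (simp add: sorted_wrt_map)
  moreover have "\<exists>a b. y = p ^ a * q ^ b" if "y \<in> set ys" for y
  proof -
    have "?m * y \<in> set xs"
      using that by (subst xs) (simp only: set_map imageI)
    then obtain a b where ab: "?m * y = p ^ a * q ^ b"
      using assms(4) by (auto simp: strictly_chained_def)
    have "p ^ c dvd p ^ a"
    proof -
      have "p ^ c dvd p ^ a * q ^ b"
        by (metis ab dvd_triv_left mult.assoc)
      moreover have "coprime (p ^ c) (q ^ b)"
        using assms(3) by simp
      ultimately show ?thesis
        by (simp add: coprime_dvd_mult_left_iff)
    qed
    then have "c \<le> a"
      using assms(1) by (simp add: power_dvd_imp_le)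
    have "b \<noteq> 0"
    proof
      assume "b = 0"
      then have "q dvd p ^ a"
        using ab by (metis dvd_mult2 dvd_triv_right mult.right_neutral power_0)
      then show False
        using not_dvd_power_coprime[OF assms(2,3)] by blast
    qed
    have "?m * y = ?m * (p ^ (a - c) * q ^ (b - 1))"
    proof -
      have "p ^ a = p ^ c * p ^ (a - c)" "q ^ b = q * q ^ (b - 1)"
        using \<open>c \<le> a\<close> \<open>b \<noteq> 0\<close> by (simp_all flip: power_add power_Suc)
      then show ?thesis
        using ab by (simp add: ac_simps)
    qed
    then show ?thesis
      using assms(1,2) by auto
  qed
  ultimately show "strictly_chained p q ys"
    by (simp add: strictly_chained_iff)
qed

section \<open>The two unmixed classes\<close>

text \<open>Multiplying all parts by \<open>q\<close> is injective, and
  \<open>strictly_chained_unscale\<close> with \<open>c = 0\<close> shows that every such partition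
  is reached.\<close>

lemma card_all_dvd:
  assumes "p > 1" "q > 1" "coprime p q"
  shows "card {xs \<in> chained_partitions p q n. \<forall>x \<in> set xs. q dvd x} = W p q (real n / real q)"
proof -
  let ?S = "{ys. strictly_chained p q ys \<and> q * sum_list ys = n}"
  have "{xs \<in> chained_partitions p q n. \<forall>x \<in> set xs. q dvd x} = map ((*) q) ` ?S"
    (is "?A = _")
  proof (intro equalityI subsetI)
    fix xs assume "xs \<in> ?A"
    moreover from this obtain ys where "strictly_chained p q ys" "xs = map ((*) q) ys"
      using strictly_chained_unscale[OF assms, of xs 0] by (auto simp: chained_partitions_def)
    ultimately show "xs \<in> map ((*) q) ` ?S"
      by (auto simp: chained_partitions_def sum_list_const_mult)
  next
    fix xs assume "xs \<in> map ((*) q) ` ?S"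
    then show "xs \<in> ?A"
      using strictly_chained_scale[of p q _ 0 1] assms
      by (auto simp: chained_partitions_def sum_list_const_mult)
  qed
  moreover have "inj_on (map ((*) q)) ?S"
    using assms by (auto intro!: inj_on_subset[OF inj_mapI] simp: inj_def)
  ultimately show ?thesis
    using assms by (simp add: W_divide card_image)
qed

lemma card_none_dvd:
  assumes "p > 1" "q > 1" "coprime p q"
  shows "card {xs \<in> chained_partitions p q n. \<forall>x \<in> set xs. \<not> q dvd x} = Wp p n"
proof -
  have "{xs \<in> chained_partitions p q n. \<forall>x \<in> set xs. \<not> q dvd x} =
      {xs. distinct_powers p xs \<and> sum_list xs = n}"
    using chained_not_dvd_distinct_powers distinct_powers_chained[OF assms(1)]
      not_dvd_distinct_powers[OF assms(2,3)]
    by (auto simp: chained_partitions_def)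
  then show ?thesis
    by (simp add: Wp_eq_card_lists)
qed

section \<open>Mixed partitions\<close>

text \<open>The part \<open>p ^ c\<close> is the first one that \<open>q\<close> does not divide
  (for \<open>q > 1\<close> coprime to \<open>p\<close>), so the partition determines
  \<open>c\<close>. Requiring \<open>ys \<noteq> []\<close> keeps out sums of powers of
  \<open>p\<close> alone.\<close>

definition mixed_partitions :: "nat \<Rightarrow> nat \<Rightarrow> nat \<Rightarrow> nat \<Rightarrow> nat list set" where
  "mixed_partitions p q n c = {ys @ p ^ c # zs | ys zs.
     ys @ p ^ c # zs \<in> chained_partitions p q n \<and> ys \<noteq> [] \<and>
     (\<forall>y \<in> set ys. q dvd y) \<and> (\<forall>z \<in> set zs. \<not> q dvd z)}"

text \<open>The block before the first element violating \<open>P\<close> is recovered by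
  \<open>takeWhile P\<close>.\<close>

lemma append_Cons_eq_iff_split:
  assumes "\<forall>y \<in> set ys. P y" "\<not> P x" "\<forall>y \<in> set ys'. P y" "\<not> P x'"
  shows "ys @ x # zs = ys' @ x' # zs' \<longleftrightarrow> ys = ys' \<and> x = x' \<and> zs = zs'"
proof
  assume eq: "ys @ x # zs = ys' @ x' # zs'"
  have "takeWhile P (ys @ x # zs) = ys" "takeWhile P (ys' @ x' # zs') = ys'"
    using assms by (simp_all add: takeWhile_append2)
  then show "ys = ys' \<and> x = x' \<and> zs = zs'"
    using eq by auto
qed simp

text \<open>Both \<open>p ^ c\<close> and \<open>q\<close> divide each part before the pivot
  \<open>p ^ c\<close>; being coprime, their product can be divided out. The later parts are
  distinct powers of \<open>p\<close> below the pivot, so their sum is below it too.\<close>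

lemma mixed_partitionsE:
  assumes "p > 1" "q > 1" "coprime p q" "xs \<in> mixed_partitions p q n c"
  obtains ys zs where "xs = map ((*) (p ^ c * q)) ys @ p ^ c # zs"
    "strictly_chained p q ys" "ys \<noteq> []" "distinct_powers p zs"
    "n = p ^ c * (q * sum_list ys + 1) + sum_list zs" "sum_list zs < p ^ c" "sum_list ys > 0"
proof -
  obtain us zs where xs: "xs = us @ p ^ c # zs" "us \<noteq> []"
    and part: "strictly_chained p q xs" "sum_list xs = n"
    and dvd: "\<forall>y \<in> set us. q dvd y" "\<forall>z \<in> set zs. \<not> q dvd z"
    using assms(4) by (auto simp: mixed_partitions_def chained_partitions_def)
  have us: "strictly_chained p q us" and zs: "strictly_chained p q zs"
    and less: "\<forall>z \<in> set zs. z < p ^ c" and "\<forall>y \<in> set us. p ^ c dvd y"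
    using part(1) unfolding xs strictly_chained_iff by (auto simp: sorted_wrt_append)
  moreover have "coprime (p ^ c) q"
    using assms(3) by simp
  ultimately have "\<forall>y \<in> set us. p ^ c * q dvd y"
    using dvd(1) by (simp add: divides_mult)
  then obtain ys where ys: "strictly_chained p q ys" "us = map ((*) (p ^ c * q)) ys"
    using strictly_chained_unscale[OF assms(1-3) us] by blast
  have zs': "distinct_powers p zs"
    using chained_not_dvd_distinct_powers[OF zs dvd(2)] .
  have "ys \<noteq> []"
    using xs(2) ys(2) by simp
  moreover have "\<forall>y \<in> set ys. y > 0"
    using ys(1) assms(1,2) by (auto simp: strictly_chained_def)
  ultimately have "sum_list ys > 0"
    by (cases ys) auto
  show thesis
  proof (rule that)
    show "xs = map ((*) (p ^ c * q)) ys @ p ^ c # zs"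
      using xs ys by simp
    show "n = p ^ c * (q * sum_list ys + 1) + sum_list zs"
      using part(2) xs(1) ys(2) by (simp add: sum_list_const_mult algebra_simps)
  qed (use distinct_powers_sum_less[OF assms(1) zs' less] ys zs' \<open>ys \<noteq> []\<close> \<open>sum_list ys > 0\<close> in auto)
qed

text \<open>The pivot \<open>p ^ c\<close> properly divides every scaled part and is a proper
  multiple of every element of \<open>zs\<close>, so transitivity settles all pairs across the two
  blocks.\<close>

lemma mixed_partitionsI:
  assumes "p > 1" "q > 1" "coprime p q"
    and "strictly_chained p q ys" "ys \<noteq> []" "distinct_powers p zs" "sum_list zs < p ^ c"
    and "n = p ^ c * (q * sum_list ys + 1) + sum_list zs"
  shows "map ((*) (p ^ c * q)) ys @ p ^ c # zs \<in> mixed_partitions p q n c"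
proof -
  let ?us = "map ((*) (p ^ c * q)) ys"
  have us: "strictly_chained p q ?us"
    using strictly_chained_scale[OF _ _ assms(4), of c 1] assms(1,2) by simp
  have "distinct_powers p (p ^ c # zs)"
    using assms(6,7) member_le_sum_list[of _ zs] by (fastforce simp: distinct_powers_Cons)
  then have ws: "strictly_chained p q (p ^ c # zs)"
    using distinct_powers_chained[OF assms(1)] by blast
  have "p ^ c dvd x \<and> p ^ c < x" if x: "x \<in> set ?us" for x
  proof -
    obtain y where y: "y \<in> set ys" "x = p ^ c * q * y"
      using x by auto
    have "y > 0"
      using y(1) assms(1,2,4) by (auto simp: strictly_chained_def)
    \<comment> \<open>The factor \<open>q\<close> makes \<open>p ^ c < x\<close> strict even for
      \<open>y = 1\<close>.\<close>
    then have "1 < q * y"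
      using assms(2) by (metis less_1_mult less_one linorder_neqE_nat mult.right_neutral not_gr_zero)
    then show ?thesis
      using y(2) assms(1) by (simp add: mult.assoc)
  qed
  moreover have "z dvd p ^ c \<and> z < p ^ c" if "z \<in> set zs" for z
    using ws that by (auto simp: strictly_chained_iff)
  ultimately have "w dvd x \<and> w < x" if "x \<in> set ?us" "w \<in> set (p ^ c # zs)" for x w
    using that by (metis dvd_trans order_less_trans set_ConsD)
  then have "strictly_chained p q (?us @ p ^ c # zs)"
    using us ws unfolding strictly_chained_iff sorted_wrt_append set_append by blast
  moreover have "sum_list (?us @ p ^ c # zs) = n"
    using assms(8) by (simp add: sum_list_const_mult algebra_simps)
  moreover have "\<forall>z \<in> set zs. \<not> q dvd z"
    using not_dvd_distinct_powers[OF assms(2,3,6)] by blast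
  ultimately show ?thesis
    using assms(5) unfolding mixed_partitions_def chained_partitions_def by fastforce
qed

text \<open>The upper block contributes at least \<open>p ^ c * q\<close> and the pivot another
  \<open>p ^ c\<close>. This is the source of the range of \<open>c\<close> in the
  recursion.\<close>

lemma mixed_partitions_bound:
  assumes "p > 1" "q > 1" "coprime p q" "mixed_partitions p q n c \<noteq> {}"
  shows "p ^ c * (q + 1) \<le> n"
proof -
  obtain xs where "xs \<in> mixed_partitions p q n c"
    using assms(4) by blast
  then obtain ys zs :: "nat list" where n: "n = p ^ c * (q * sum_list ys + 1) + sum_list zs"
    and "sum_list ys > 0"
    by (rule mixed_partitionsE[OF assms(1-3)])
  then have "q + 1 \<le> q * sum_list ys + 1"
    by simp
  then have "p ^ c * (q + 1) \<le> p ^ c * (q * sum_list ys + 1)"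
    by (rule mult_le_mono2)
  then show ?thesis
    using n by linarith
qed

text \<open>A mixed partition amounts to two independent choices: a chained partition of
  \<open>V\<close>, counted by \<open>W\<close>, and distinct powers of \<open>p\<close> with sum
  \<open>R\<close>, counted by \<open>delta\<close>.\<close>

lemma card_mixed_partitions:
  assumes "p > 1" "q > 1" "coprime p q" "p ^ c * (q + 1) \<le> n"
  shows "card (mixed_partitions p q n c) = delta p q c n * W p q (real (n div (p ^ c * q)))"
proof -
  define V R where "V = n div (p ^ c * q)" and "R = n mod p ^ c"
  have V: "V = n div p ^ c div q"
    by (simp add: V_def div_mult2_eq)
  have pc: "p ^ c > 0"
    using assms(1) by simp
  \<comment> \<open>Division with remainder is used twice: by \<open>p ^ c\<close> with remainder
    \<open>r\<close>, then by \<open>q\<close> with remainder 1, which is reduced since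
    \<open>q > 1\<close>.\<close>
  have sum_iff: "n = p ^ c * (q * v + 1) + r \<longleftrightarrow>
      [n div p ^ c = 1] (mod q) \<and> v = V \<and> r = R" if "r < p ^ c" for v r
  proof
    assume n: "n = p ^ c * (q * v + 1) + r"
    have "n div p ^ c = q * v + 1" "n mod p ^ c = r"
      using that unfolding n by (simp_all only: div_mult_self4 mod_mult_self4) simp_all
    moreover have "(q * v + 1) mod q = 1 mod q" "(q * v + 1) div q = v"
      using assms(2) div_mult_self4[of q v 1] by (simp_all only: mod_mult_self4) simp
    ultimately show "[n div p ^ c = 1] (mod q) \<and> v = V \<and> r = R"
      by (simp add: V R_def cong_def)
  next
    assume asm: "[n div p ^ c = 1] (mod q) \<and> v = V \<and> r = R"
    then have "n div p ^ c mod q = 1"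
      using assms(2) by (simp add: cong_def)
    then have "n div p ^ c = q * V + 1"
      unfolding V by (metis mult_div_mod_eq)
    then show "n = p ^ c * (q * v + 1) + r"
      using asm unfolding R_def by (metis mult_div_mod_eq)
  qed
  let ?P = "{zs. distinct_powers p zs \<and> sum_list zs = R}"
  let ?f = "\<lambda>(ys, zs). map ((*) (p ^ c * q)) ys @ p ^ c # zs"
  show ?thesis
  proof (cases "[n div p ^ c = 1] (mod q)")
    case False
    have "mixed_partitions p q n c = {}"
    proof (rule ccontr)
      assume "mixed_partitions p q n c \<noteq> {}"
      then obtain xs where "xs \<in> mixed_partitions p q n c"
        by blast
      then show False
        by (rule mixed_partitionsE[OF assms(1-3)]) (use sum_iff False in blast)
    qed
    then show ?thesis
      using False by (simp add: delta_def)
  next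
    case True
    \<comment> \<open>The bound on \<open>c\<close> yields \<open>V > 0\<close>. With
      \<open>V = 0\<close> the product would count the empty upper block, which
      \<open>mixed_partitions\<close> excludes.\<close>
    have "q + 1 \<le> n div p ^ c"
      using assms(4) pc by (simp only: less_eq_div_iff_mult_less_eq mult.commute)
    then have "q div q \<le> V"
      unfolding V by (intro div_le_mono) simp
    then have "V > 0"
      using assms(2) by simp
    have "R < p ^ c"
      using pc by (simp add: R_def)
    have "mixed_partitions p q n c = ?f ` (chained_partitions p q V \<times> ?P)"
    proof (intro equalityI subsetI)
      fix xs assume "xs \<in> mixed_partitions p q n c"
      then show "xs \<in> ?f ` (chained_partitions p q V \<times> ?P)"
      proof (rule mixed_partitionsE[OF assms(1-3)])
        fix ys zs
        assume xs: "xs = map ((*) (p ^ c * q)) ys @ p ^ c # zs"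
          and "strictly_chained p q ys" "distinct_powers p zs"
          and "n = p ^ c * (q * sum_list ys + 1) + sum_list zs" "sum_list zs < p ^ c"
        then have "(ys, zs) \<in> chained_partitions p q V \<times> ?P"
          using sum_iff[of "sum_list zs" "sum_list ys"] by (simp add: chained_partitions_def)
        then show ?thesis
          using xs by (intro image_eqI[where x = "(ys, zs)"]) auto
      qed
    next
      fix xs assume "xs \<in> ?f ` (chained_partitions p q V \<times> ?P)"
      then obtain ys zs where xs: "xs = map ((*) (p ^ c * q)) ys @ p ^ c # zs"
        and ys: "strictly_chained p q ys" "sum_list ys = V"
        and zs: "distinct_powers p zs" "sum_list zs = R"
        by (auto simp: chained_partitions_def)
      have "n = p ^ c * (q * sum_list ys + 1) + sum_list zs"
        using sum_iff[OF \<open>R < p ^ c\<close>, of V] True ys zs by simp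
      moreover have "ys \<noteq> []"
        using ys(2) \<open>V > 0\<close> by auto
      ultimately show "xs \<in> mixed_partitions p q n c"
        unfolding xs using mixed_partitionsI[OF assms(1-3) ys(1)] zs \<open>R < p ^ c\<close> by blast
    qed
    moreover have "inj_on ?f (chained_partitions p q V \<times> ?P)"
    proof (rule inj_onI, clarify)
      fix ys zs ys' zs'
      assume eq: "map ((*) (p ^ c * q)) ys @ p ^ c # zs = map ((*) (p ^ c * q)) ys' @ p ^ c # zs'"
      \<comment> \<open>Scaled parts are divisible by \<open>q\<close> and the pivot is not, so the
        list itself shows where it is to be split.\<close>
      have "\<forall>x \<in> set (map ((*) (p ^ c * q)) us). q dvd x" for us
        by (auto simp: mult.assoc)
      then have "map ((*) (p ^ c * q)) ys = map ((*) (p ^ c * q)) ys' \<and> zs = zs'"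
        using eq not_dvd_power_coprime[OF assms(2,3)]
        by (subst (asm) append_Cons_eq_iff_split[where P = "\<lambda>x. q dvd x"]) blast+
      moreover have "inj ((*) (p ^ c * q))"
        using assms(1,2) by (simp add: inj_def)
      ultimately show "ys = ys' \<and> zs = zs'"
        by (simp add: inj_map_eq_map)
    qed
    ultimately have "card (mixed_partitions p q n c) = card (chained_partitions p q V) * card ?P"
      by (simp add: card_image card_cartesian_product)
    also have "card ?P = delta p q c n"
      using True by (simp add: delta_eq[OF assms(1)] Wp_eq_card_lists R_def)
    finally show ?thesis
      by (simp add: W_of_nat V_def)
  qed
qed

section \<open>Decomposition and recursion\<close>

lemma chained_partitions_decomp:
  assumes "p > 1" "q > 1" "coprime p q"
  shows "chained_partitions p q n =
    {xs \<in> chained_partitions p q n. \<forall>x \<in> set xs. \<not> q dvd x} \<union>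
    {xs \<in> chained_partitions p q n. \<forall>x \<in> set xs. q dvd x} \<union>
    (\<Union>c \<in> {c. p ^ c * (q + 1) \<le> n}. mixed_partitions p q n c)" (is "_ = ?B \<union> ?A \<union> ?C")
proof (intro equalityI subsetI)
  fix xs assume xs: "xs \<in> chained_partitions p q n"
  show "xs \<in> ?B \<union> ?A \<union> ?C"
  \<comment> \<open>The list is cut at its first part not divisible by \<open>q\<close>, if there is
    one.\<close>
  proof (cases "dropWhile (\<lambda>x. q dvd x) xs")
    case Nil
    then show ?thesis
      using xs by simp
  next
    case (Cons w zs)
    define ys where "ys = takeWhile (\<lambda>x. q dvd x) xs"
    have split: "xs = ys @ w # zs"
      unfolding ys_def Cons[symmetric] by simp
    have ys: "\<forall>y \<in> set ys. q dvd y"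
      unfolding ys_def by (auto dest: set_takeWhileD)
    have w: "\<not> q dvd w"
      using Cons hd_dropWhile[of "\<lambda>x. q dvd x" xs] by simp
    have chained: "strictly_chained p q (ys @ w # zs)"
      using xs split by (simp add: chained_partitions_def)
    \<comment> \<open>Later parts divide \<open>w\<close>, so divisibility by \<open>q\<close>
      cannot return after \<open>w\<close>.\<close>
    then have "\<forall>z \<in> set zs. z dvd w"
      by (simp add: strictly_chained_iff sorted_wrt_append)
    then have zs: "\<forall>z \<in> set zs. \<not> q dvd z"
      using w dvd_trans by blast
    have "strictly_chained p q (w # zs)"
      using chained by (auto simp: strictly_chained_iff sorted_wrt_append)
    then have "distinct_powers p (w # zs)"
      using w zs by (intro chained_not_dvd_distinct_powers) auto
    then obtain c where c: "w = p ^ c"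
      by (auto simp: distinct_powers_Cons)
    show ?thesis
    proof (cases "ys = []")
      case True
      then show ?thesis
        using xs split w zs by simp
    next
      case False
      then have "xs \<in> mixed_partitions p q n c"
        using xs ys zs unfolding split c mixed_partitions_def by blast
      moreover from this have "p ^ c * (q + 1) \<le> n"
        using mixed_partitions_bound[OF assms] by blast
      ultimately show ?thesis
        by blast
    qed
  qed
qed (auto simp: mixed_partitions_def)

lemma W_recursion_nat:
  assumes "p > 1" "q > 1" "coprime p q" "n \<ge> 1"
  shows "W p q (real n) = Wp p n + W p q (real n / real q) +
    (\<Sum>c | p ^ c * (q + 1) \<le> n. delta p q c n * W p q (real (n div (p ^ c * q))))"
proof -
  let ?A = "{xs \<in> chained_partitions p q n. \<forall>x \<in> set xs. q dvd x}"
  let ?B = "{xs \<in> chained_partitions p q n. \<forall>x \<in> set xs. \<not> q dvd x}"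
  let ?D = "{c. p ^ c * (q + 1) \<le> n}"
  let ?C = "\<Union>c \<in> ?D. mixed_partitions p q n c"
  have nd: "\<not> q dvd p ^ c" for c
    by (rule not_dvd_power_coprime[OF assms(2,3)])
  have "c \<le> n" if "p ^ c * (q + 1) \<le> n" for c
  proof -
    have "c < p ^ c"
      using assms(1) by (intro power_gt_expt) simp
    also have "p ^ c \<le> p ^ c * (q + 1)"
      by simp
    finally show ?thesis
      using that by simp
  qed
  then have "?D \<subseteq> {..n}"
    by blast
  then have "finite ?D"
    by (rule finite_subset) simp
  have fin: "finite (chained_partitions p q n)"
    using assms by (simp add: finite_chained_partitions)
  have sub: "mixed_partitions p q n c \<subseteq> chained_partitions p q n" for c
    by (auto simp: mixed_partitions_def)
  \<comment> \<open>Only the empty list could lie in both classes, and \<open>n \<ge> 1\<close>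
    excludes it.\<close>
  have disj: "?B \<inter> ?A = {}"
  proof -
    have "xs \<noteq> []" if "xs \<in> chained_partitions p q n" for xs
      using assms(4) that by (auto simp: chained_partitions_def)
    then show ?thesis
      using hd_in_set by blast
  qed
  have disj': "(?B \<union> ?A) \<inter> ?C = {}"
  proof -
    have "xs \<notin> ?B \<union> ?A" if "xs \<in> mixed_partitions p q n c" for xs c
    proof -
      obtain ys zs where "xs = ys @ p ^ c # zs" "ys \<noteq> []" "\<forall>y \<in> set ys. q dvd y"
        using \<open>xs \<in> mixed_partitions p q n c\<close> by (auto simp: mixed_partitions_def)
      then have "p ^ c \<in> set xs" "hd ys \<in> set xs" "q dvd hd ys"
        by simp_all
      then show ?thesis
        using nd by blast
    qed
    then show ?thesis
      by blast
  qed
  have finC: "finite ?C"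
    using sub by (intro finite_subset[OF _ fin]) auto
  have finAB: "finite ?A" "finite ?B"
    using fin by auto
  have "card (chained_partitions p q n) = card (?B \<union> ?A \<union> ?C)"
    by (rule arg_cong[where f = card, OF chained_partitions_decomp[OF assms(1-3)]])
  also have "\<dots> = card (?B \<union> ?A) + card ?C"
    by (rule card_Un_disjoint[OF finite_UnI[OF finAB(2,1)] finC disj'])
  also have "card (?B \<union> ?A) = card ?B + card ?A"
    by (rule card_Un_disjoint[OF finAB(2,1) disj])
  also have "card ?C = (\<Sum>c \<in> ?D. card (mixed_partitions p q n c))"
  proof (rule card_UN_disjoint)
    show "\<forall>c \<in> ?D. \<forall>d \<in> ?D. c \<noteq> d \<longrightarrow> mixed_partitions p q n c \<inter> mixed_partitions p q n d = {}"
    proof (intro ballI impI, rule ccontr)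
      fix c d assume "c \<noteq> d" "mixed_partitions p q n c \<inter> mixed_partitions p q n d \<noteq> {}"
      then obtain ys zs ys' zs' where "ys @ p ^ c # zs = ys' @ p ^ d # zs'"
        and "\<forall>y \<in> set ys. q dvd y" "\<forall>y \<in> set ys'. q dvd y"
        by (auto simp: mixed_partitions_def)
      \<comment> \<open>Equal lists have the same first part not divisible by
        \<open>q\<close>.\<close>
      then have "p ^ c = p ^ d"
        using append_Cons_eq_iff_split[of ys "\<lambda>x. q dvd x" "p ^ c" ys' "p ^ d" zs zs'] nd by blast
      then show False
        using \<open>c \<noteq> d\<close> assms(1) by simp
    qed
  qed (use \<open>finite ?D\<close> fin sub in \<open>auto intro: finite_subset\<close>)
  \<comment> \<open>Membership in \<open>?D\<close> supplies the bound required by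
    \<open>card_mixed_partitions\<close>.\<close>
  also have "\<dots> = (\<Sum>c \<in> ?D. delta p q c n * W p q (real (n div (p ^ c * q))))"
    using card_mixed_partitions[OF assms(1-3)] by (intro sum.cong) auto
  finally show ?thesis
    by (simp only: W_of_nat card_all_dvd[OF assms(1-3)] card_none_dvd[OF assms(1-3)])
qed

theorem theorem4p2:
  fixes p q :: nat
  assumes "p > 1" and "q > 1" and "coprime p q"
  shows "(\<forall>u::real. u \<notin> \<nat> \<longrightarrow> W p q u = 0) \<and>
    (\<forall>U::nat. U \<ge> 1 \<longrightarrow>
      W p q (real U) = Wp p U + W p q (real U / real q) +
        (\<Sum>c | int c \<le> \<lfloor>log (real p) (real U / (real q + 1))\<rfloor>.
           delta p q c U * W p q (real_of_int \<lfloor>real U / (real p ^ c * real q)\<rfloor>)))"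
proof (intro conjI allI impI)
  fix U :: nat assume U: "U \<ge> 1"
  \<comment> \<open>Here \<open>U \<ge> 1\<close> makes the argument of \<open>log\<close> positive.
    For \<open>U < q + 1\<close> the floor is negative and no natural \<open>c\<close> qualifies, in
    agreement with the right-hand side.\<close>
  have "int c \<le> \<lfloor>log (real p) (real U / (real q + 1))\<rfloor> \<longleftrightarrow> p ^ c * (q + 1) \<le> U" for c
  proof -
    have "int c \<le> \<lfloor>log (real p) (real U / (real q + 1))\<rfloor> \<longleftrightarrow>
        real c \<le> log (real p) (real U / (real q + 1))"
      by (simp add: le_floor_iff)
    also have "\<dots> \<longleftrightarrow> real p ^ c \<le> real U / (real q + 1)"
      using assms U by (subst le_log_iff) (auto simp: powr_realpow)
    also have "\<dots> \<longleftrightarrow> real (p ^ c * (q + 1)) \<le> real U"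
      by (simp add: pos_le_divide_eq algebra_simps)
    also have "\<dots> \<longleftrightarrow> p ^ c * (q + 1) \<le> U"
      by (rule of_nat_le_iff)
    finally show ?thesis .
  qed
  moreover have "real_of_int \<lfloor>real U / (real p ^ c * real q)\<rfloor> = real (U div (p ^ c * q))" for c
    using floor_divide_of_nat_eq[of U "p ^ c * q", where ?'a = real] by simp
  ultimately show "W p q (real U) = Wp p U + W p q (real U / real q) +
        (\<Sum>c | int c \<le> \<lfloor>log (real p) (real U / (real q + 1))\<rfloor>.
           delta p q c U * W p q (real_of_int \<lfloor>real U / (real p ^ c * real q)\<rfloor>))"
    using W_recursion_nat[OF assms U] by simp
qed (rule W_not_Nats)

end
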